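(* Let $2 \le n \in \mathbb{N}$ and let $J \in \mathcal{B}(\mathbb{C}^n)$ be nilpotent. The following are equivalent: (a) $J = MN - NM$ for some $M, N \in \mathcal{B}(\mathbb{C}^n)$ with $M^2 = 0 = N^2$; (b) $J$ admits a square root, i.e. $J = Q^2$ for some $Q \in \mathcal{B}(\mathbb{C}^n)$. *)

theory Defs
  imports "HOL-Analysis.Analysis"
begin

primrec mat_pow :: "'a::semiring_1 ^ 'n ^ 'n \<Rightarrow> nat \<Rightarrow> 'a ^ 'n ^ 'n" where
  "mat_pow A 0 = mat 1"
| "mat_pow A (Suc k) = A ** mat_pow A k"

definition nilpotent_mat :: "'a::semiring_1 ^ 'n ^ 'n \<Rightarrow> bool" where
  "nilpotent_mat A \<longleftrightarrow> (\<exists>k. mat_pow A k = 0)"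

end

theory Submission
  imports Defs
begin

text \<open>
  Suppose \<open>J = MN - NM\<close> with \<open>M\<^sup>2 = N\<^sup>2 = 0\<close>, and put \<open>A = M + N\<close>, \<open>B = M - N\<close>, so that
  \<open>BA = J = -AB\<close> and \<open>A\<^sup>2 = -B\<^sup>2\<close>. Then \<open>A\<close> and \<open>B\<close> anticommute with \<open>J\<close> and hence preserve
  \<open>E\<^sub>i = ker J \<inter> im J\<^sup>i\<close>, whose dimension is the number of Jordan blocks of size greater than \<open>i\<close>.
  If \<open>E = E\<^sub>i\<close> equals the next space of this flag, then on \<open>E\<close> one has \<open>ker A = BE\<close> and
  \<open>ker B = AE\<close>; comparing the ranks of \<open>A\<^sup>2\<close> and \<open>B\<^sup>2\<close> on \<open>E\<close> gives \<open>dim AE = dim BE\<close>, so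
  \<open>dim E = dim AE + dim BE\<close> is even. Hence, if the Jordan blocks are listed by decreasing size and
  grouped in consecutive pairs, the sizes in a pair differ by at most one, and each
  pair is the square of a single Jordan block.

  Conversely, on a Jordan chain \<open>v\<^sub>0, v\<^sub>1, \<dots>\<close> of a square root of \<open>J\<close>, let \<open>M\<close> and \<open>N\<close> send
  \<open>v\<^sub>p\<close> to \<open>\<plusminus>v\<^sub>p\<^sub>+\<^sub>1\<close> for odd and even \<open>p\<close> respectively, and to \<open>0\<close> otherwise, with signs of
  period four.
\<close>

section \<open>Rank-nullity on subspaces and bases adapted to a flag\<close>

text \<open>A basis \<open>B0\<close> of the kernel part is extended to a basis of \<open>W\<close>;
  \<open>A\<close> is injective on the span of the added vectors \<open>C\<close> and already maps
  that span onto the image of \<open>W\<close>.\<close>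

lemma rank_nullity_on_subspace:
  fixes A :: "'a::field ^ 'n ^ 'm"
  assumes W: "vec.subspace W"
  shows "vec.dim W = vec.dim ((*v) A ` W) + vec.dim (W \<inter> {x. A *v x = 0})"
proof -
  let ?K = "W \<inter> {x. A *v x = 0}"
  obtain B0 where B0: "B0 \<subseteq> ?K" "vec.independent B0" "?K \<subseteq> vec.span B0" "card B0 = vec.dim ?K"
    using vec.basis_exists by blast
  obtain B where B: "B0 \<subseteq> B" "B \<subseteq> W" "vec.independent B" "W \<subseteq> vec.span B"
    using vec.maximal_independent_subset_extend[of B0 W] B0 by blast
  define C where "C = B - B0"
  have finB: "finite B"
    using B(3) by (rule vec.finiteI_independent)
  have indC: "vec.independent C"
    using B(3) C_def vec.independent_mono by blast
  have dimC: "vec.dim (vec.span C) = card C"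
    using indC by (rule vec.dim_span_eq_card_independent)
  have dimB0: "vec.dim (vec.span B0) = card B0"
    using B0(2) by (rule vec.dim_span_eq_card_independent)
  have dimW: "vec.dim W = card B"
    using B vec.basis_card_eq_dim by metis
  have card: "card B = card B0 + card C"
    using finB B(1) card_Diff_subset[of B0 B] card_mono[of B B0] finite_subset[of B0 B]
    by (simp add: C_def)
  have sum: "{x + y |x y. x \<in> vec.span B0 \<and> y \<in> vec.span C} = vec.span B"
    using B(1) vec.span_Un[of B0 C] by (simp add: C_def Un_absorb1)
  have "vec.dim (vec.span B0 \<inter> vec.span C) = 0"
    using vec.dim_sums_Int[OF vec.subspace_span vec.subspace_span, of B0 C]
    unfolding sum dimC dimB0 using card vec.dim_span_eq_card_independent[OF B(3)] by simp
  then have disj: "vec.span B0 \<inter> vec.span C \<subseteq> {0}"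
    by simp
  have CW: "vec.span C \<subseteq> W"
    using B(2) W C_def by (intro vec.span_minimal) auto
  have inj: "inj_on ((*v) A) (vec.span C)"
    using CW B0(3) disj
    by (subst vec.linear_inj_on_iff_eq_0) (auto simp: vec.subspace_span)
  have "(*v) A ` W = (*v) A ` vec.span C"
  proof
    show "(*v) A ` W \<subseteq> (*v) A ` vec.span C"
    proof
      fix y assume "y \<in> (*v) A ` W"
      then obtain x where x: "x \<in> W" "y = A *v x" by auto
      then obtain b c where bc: "b \<in> vec.span B0" "c \<in> vec.span C" "x = b + c"
        using B(4) sum by blast
      have "vec.subspace ?K"
        using W vec.linear_subspace_kernel[of "(*v) A"] by (intro vec.subspace_inter) auto
      then have "vec.span B0 \<subseteq> ?K"
        using B0(1) by (intro vec.span_minimal)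
      then have "A *v b = 0" using bc by auto
      then show "y \<in> (*v) A ` vec.span C"
        using x bc by (auto simp: matrix_vector_right_distrib)
    qed
  qed (use CW in auto)
  moreover have "vec.dim ((*v) A ` vec.span C) = card C"
    using vec.dim_image_eq[of "(*v) A" "vec.span C"] inj dimC by (simp add: vec.span_span)
  ultimately show ?thesis
    using dimW card B0(4) by simp
qed

text \<open>The basis grows from the small end of the flag: each step back extends the basis of the
  smaller space to one of the next larger space, so the earlier spanning properties survive.\<close>

lemma flag_basis_exists:
  fixes E :: "nat \<Rightarrow> ('a::field ^ 'n) set"
  assumes anti: "antimono E" and top: "E m \<subseteq> {0}"
  obtains B where "vec.independent B" "B \<subseteq> E 0" "\<And>i. E i \<subseteq> vec.span (B \<inter> E i)"
proof -
  have "\<exists>B. vec.independent B \<and> B \<subseteq> E (m - k) \<and> (\<forall>i\<ge>m - k. E i \<subseteq> vec.span (B \<inter> E i))" for k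
  proof (induction k)
    case 0
    have "E i \<subseteq> {0}" if "i \<ge> m" for i
      using antimonoD[OF anti that] top by blast
    then show ?case
      by (intro exI[of _ "{}"]) (auto simp: vec.independent_empty)
  next
    case (Suc k)
    then obtain B where B: "vec.independent B" "B \<subseteq> E (m - k)"
      "\<And>i. i \<ge> m - k \<Longrightarrow> E i \<subseteq> vec.span (B \<inter> E i)" by blast
    have "B \<subseteq> E (m - Suc k)"
      using B(2) antimonoD[OF anti diff_le_mono2[of k "Suc k" m]] by auto
    then obtain B' where B': "B \<subseteq> B'" "B' \<subseteq> E (m - Suc k)" "vec.independent B'"
      "E (m - Suc k) \<subseteq> vec.span B'"
      using vec.maximal_independent_subset_extend[OF _ B(1)] by metis
    have "E i \<subseteq> vec.span (B' \<inter> E i)" if "i \<ge> m - Suc k" for i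
    proof (cases "i \<ge> m - k")
      case True
      then show ?thesis
        using B(3)[OF True] vec.span_mono[of "B \<inter> E i" "B' \<inter> E i"] B'(1) by blast
    next
      case False
      then have "i = m - Suc k" using that by auto
      then show ?thesis using B'(2,4) by (simp add: Int_absorb2)
    qed
    then show ?case using B' by blast
  qed
  from this[of m] that show thesis by auto
qed

section \<open>Powers of a matrix and the flag of its kernel\<close>

lemma mat_pow_add: "mat_pow A (p + q) = mat_pow A p ** mat_pow A q"
  by (induction p) (simp_all add: matrix_mul_assoc)

lemma mat_pow_Suc_vec: "mat_pow A p *v (A *v x) = A *v (mat_pow A p *v x)"
  by (induction p) (simp_all flip: matrix_vector_mul_assoc)

definition socle_flag :: "'a::field ^ 'n ^ 'n \<Rightarrow> nat \<Rightarrow> ('a ^ 'n) set" where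
  "socle_flag J i = {x. J *v x = 0} \<inter> range ((*v) (mat_pow J i))"

lemma subspace_socle_flag: "vec.subspace (socle_flag J i)"
  unfolding socle_flag_def
  using vec.linear_subspace_kernel[of "(*v) J"] vec.linear_subspace_image[of "(*v) (mat_pow J i)"]
  by (intro vec.subspace_inter) auto

lemma range_mat_pow_Suc: "range ((*v) (mat_pow J (Suc i))) = (*v) J ` range ((*v) (mat_pow J i))"
  by (auto simp: image_image simp flip: matrix_vector_mul_assoc)

lemma range_mat_pow_antimono: "antimono (\<lambda>i. range ((*v) (mat_pow J i)))"
proof (rule decseq_SucI)
  show "range ((*v) (mat_pow J (Suc i))) \<subseteq> range ((*v) (mat_pow J i))" for i
    by (auto simp flip: matrix_vector_mul_assoc mat_pow_Suc_vec)
qed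

lemma socle_flag_antimono: "antimono (socle_flag J)"
  using range_mat_pow_antimono[of J] unfolding socle_flag_def antimono_def by blast

lemma dim_range_mat_pow:
  "vec.dim (range ((*v) (mat_pow J i))) =
     vec.dim (range ((*v) (mat_pow J (Suc i)))) + vec.dim (socle_flag J i)"
  unfolding range_mat_pow_Suc socle_flag_def
  by (subst rank_nullity_on_subspace[of _ J])
    (auto simp: vec.linear_subspace_image Int_commute)

text \<open>The rank drops from \<open>mat_pow J i\<close> to \<open>mat_pow J (Suc i)\<close>
  telescope down to rank 0.\<close>

lemma nilpotent_dim_eq_sum_socle_flag:
  fixes J :: "'a::field ^ 'n ^ 'n"
  assumes "mat_pow J m = 0"
  shows "CARD('n) = (\<Sum>i<m. vec.dim (socle_flag J i))"
proof -
  have "vec.dim (UNIV :: ('a^'n) set) =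
      vec.dim (range ((*v) (mat_pow J k))) + (\<Sum>i<k. vec.dim (socle_flag J i))" for k
  proof (induction k)
    case 0
    then show ?case by simp
  next
    case (Suc k)
    then show ?case using dim_range_mat_pow[of J k] by simp
  qed
  from this[of m] show ?thesis
    using assms by (simp add: card_cart_basis image_constant_conv)
qed

section \<open>Anticommuting matrices on the flag and the parity argument\<close>

lemma anticommuting_preserves_range_mat_pow:
  fixes J :: "'a::field ^ 'n ^ 'n"
  assumes "\<And>x. A *v (J *v x) = - (J *v (A *v x))"
  shows "\<exists>y. A *v (mat_pow J i *v x) = mat_pow J i *v y"
proof (induction i)
  case 0
  then show ?case by auto
next
  case (Suc i)
  then obtain y where y: "A *v (mat_pow J i *v x) = mat_pow J i *v y" by blast
  have "A *v (mat_pow J (Suc i) *v x) = - (J *v (mat_pow J i *v y))"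
    using assms[of "mat_pow J i *v x"] y by (simp flip: matrix_vector_mul_assoc)
  also have "\<dots> = mat_pow J (Suc i) *v (- y)"
    by (simp add: vec.neg flip: matrix_vector_mul_assoc)
  finally show ?case by blast
qed

lemma socle_flag_anticommuting_invariant:
  fixes J :: "'a::field ^ 'n ^ 'n"
  assumes "\<And>x. A *v (J *v x) = - (J *v (A *v x))"
  shows "(*v) A ` socle_flag J i \<subseteq> socle_flag J i"
proof
  fix y assume "y \<in> (*v) A ` socle_flag J i"
  then obtain z where z: "J *v (mat_pow J i *v z) = 0" "y = A *v (mat_pow J i *v z)"
    by (auto simp: socle_flag_def)
  show "y \<in> socle_flag J i"
    using z assms[of "mat_pow J i *v z"] anticommuting_preserves_range_mat_pow[of A J i z] assms
    by (auto simp: socle_flag_def)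
qed

text \<open>The scalars \<open>c\<close> and \<open>d\<close> carry the signs, so that one statement
  serves both for \<open>A\<close>, \<open>B\<close> and with the two exchanged.\<close>

lemma kernel_on_stable_socle:
  fixes J :: "'a::field ^ 'n ^ 'n"
  assumes J: "\<And>x. J *v x = c *s (B *v (A *v x))"
    and AB: "\<And>x. A *v (B *v x) = d *s (J *v x)"
    and A: "\<And>x. A *v (J *v x) = - (J *v (A *v x))"
    and B: "\<And>x. B *v (J *v x) = - (J *v (B *v x))"
    and stable: "socle_flag J (Suc i) = socle_flag J i"
  shows "socle_flag J i \<inter> {x. A *v x = 0} = (*v) B ` socle_flag J i"
proof
  show "(*v) B ` socle_flag J i \<subseteq> socle_flag J i \<inter> {x. A *v x = 0}"
    using socle_flag_anticommuting_invariant[of B J i] B AB by (auto simp: socle_flag_def)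
  show "socle_flag J i \<inter> {x. A *v x = 0} \<subseteq> (*v) B ` socle_flag J i"
  proof
    fix v assume v: "v \<in> socle_flag J i \<inter> {x. A *v x = 0}"
    then have "v \<in> socle_flag J (Suc i)" using stable by simp
    then obtain u where u: "v = J *v (mat_pow J i *v u)"
      by (auto simp: socle_flag_def simp flip: matrix_vector_mul_assoc)
    \<comment> \<open>Stability supplies one more factor \<open>J\<close> in \<open>v\<close>;
      writing that factor as \<open>c\<close> times \<open>B\<close> after \<open>A\<close> exhibits
      \<open>v\<close> as \<open>B\<close> applied to \<open>c *s w\<close>.\<close>
    define w where "w = A *v (mat_pow J i *v u)"
    have "J *v w = - (A *v v)"
      using A[of "mat_pow J i *v u"] by (simp add: u w_def)
    then have "w \<in> socle_flag J i"
      using v anticommuting_preserves_range_mat_pow[of A J i u] A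
      by (auto simp: socle_flag_def w_def)
    then have "c *s w \<in> socle_flag J i"
      by (rule vec.subspace_scale[OF subspace_socle_flag])
    moreover have "v = B *v (c *s w)"
      by (simp add: u w_def J vec.scale)
    ultimately show "v \<in> (*v) B ` socle_flag J i" by blast
  qed
qed

lemma even_dim_stable_socle:
  fixes J :: "'a::field ^ 'n ^ 'n"
  assumes BA: "\<And>x. B *v (A *v x) = J *v x"
    and AB: "\<And>x. A *v (B *v x) = - (J *v x)"
    and sq: "\<And>x. A *v (A *v x) = - (B *v (B *v x))"
    and stable: "socle_flag J (Suc i) = socle_flag J i"
  shows "even (vec.dim (socle_flag J i))"
proof -
  define E where "E = socle_flag J i"
  have E: "vec.subspace E"
    unfolding E_def by (rule subspace_socle_flag)
  have A: "A *v (J *v x) = - (J *v (A *v x))" for x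
    using AB[of "A *v x"] by (simp add: BA)
  have B: "B *v (J *v x) = - (J *v (B *v x))" for x
    using AB[of x] BA[of "B *v x"] by (metis vec.neg minus_minus)
  have kerA: "E \<inter> {x. A *v x = 0} = (*v) B ` E"
    unfolding E_def
    by (rule kernel_on_stable_socle[where c = 1 and d = "-1"])
      (simp_all add: BA AB A B stable)
  have kerB: "E \<inter> {x. B *v x = 0} = (*v) A ` E"
    unfolding E_def
    by (rule kernel_on_stable_socle[where c = "-1" and d = 1])
      (simp_all add: BA AB A B stable)
  have "(*v) A ` (*v) A ` E = (*v) B ` (*v) B ` E"
  proof -
    have "(*v) A ` (*v) A ` E = (\<lambda>x. B *v (B *v x)) ` uminus ` E"
      by (simp add: image_image sq vec.neg)
    also have "uminus ` E = E"
      using vec.subspace_neg[OF E] by (force simp: image_iff)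
    finally show ?thesis by (simp add: image_image)
  qed
  \<comment> \<open>\<open>A\<close> on \<open>A E\<close> and \<open>B\<close> on
    \<open>B E\<close> have the same kernel, and by the previous step images of equal dimension;
    hence \<open>A E\<close> and \<open>B E\<close> have equal dimension.\<close>
  moreover have "(*v) A ` E \<inter> {x. A *v x = 0} = (*v) A ` E \<inter> (*v) B ` E"
    using kerA kerB by blast
  then have "vec.dim ((*v) A ` E) =
      vec.dim ((*v) A ` (*v) A ` E) + vec.dim ((*v) A ` E \<inter> (*v) B ` E)"
    using rank_nullity_on_subspace[of "(*v) A ` E" A] E vec.linear_subspace_image[of "(*v) A" E]
    by simp
  moreover have "(*v) B ` E \<inter> {x. B *v x = 0} = (*v) A ` E \<inter> (*v) B ` E"
    using kerA kerB by blast
  then have "vec.dim ((*v) B ` E) =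
      vec.dim ((*v) B ` (*v) B ` E) + vec.dim ((*v) A ` E \<inter> (*v) B ` E)"
    using rank_nullity_on_subspace[of "(*v) B ` E" B] E vec.linear_subspace_image[of "(*v) B" E]
    by simp
  moreover have "vec.dim E = vec.dim ((*v) A ` E) + vec.dim ((*v) B ` E)"
    using rank_nullity_on_subspace[OF E, of A] kerA by simp
  ultimately show ?thesis by (simp add: E_def)
qed

section \<open>Square roots and commutators from a Jordan basis\<close>

text \<open>The \<open>j\<close>-th Jordan chain has length \<open>S j\<close>; there are infinitely many indices \<open>j\<close>, all but
  finitely many of them with \<open>S j = 0\<close>.\<close>

locale jordan_basis =
  fixes J :: "'a::field ^ 'n ^ 'n" and S :: "nat \<Rightarrow> nat" and u :: "nat \<Rightarrow> 'a ^ 'n"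
  assumes antimono: "antimono S"
    and chain_end: "mat_pow J (S j) *v u j = 0"
    and inj: "inj_on (\<lambda>(j, p). mat_pow J p *v u j) {(j, p). p < S j}"
    and independent: "vec.independent ((\<lambda>(j, p). mat_pow J p *v u j) ` {(j, p). p < S j})"
    and span: "vec.span ((\<lambda>(j, p). mat_pow J p *v u j) ` {(j, p). p < S j}) = UNIV"
begin

definition v :: "nat \<Rightarrow> nat \<Rightarrow> 'a ^ 'n" where
  "v j p = mat_pow J p *v u j"

lemma J_v: "J *v v j p = v j (Suc p)"
  by (simp add: v_def matrix_vector_mul_assoc)

lemma v_eq_0: "S j \<le> p \<Longrightarrow> v j p = 0"
proof (induction p rule: dec_induct)
  case base
  then show ?case by (simp add: v_def chain_end)
next
  case (step p)
  then show ?case by (simp flip: J_v)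
qed

lemma matrix_eqI:
  assumes "\<And>j p. X *v v j p = Y *v v j p"
  shows "X = Y"
proof -
  have "X *v x = Y *v x" for x
  proof -
    have "x \<in> vec.span ((\<lambda>(j, p). mat_pow J p *v u j) ` {(j, p). p < S j})"
      by (simp add: span)
    then show ?thesis
      by (rule vec.linear_eq_on[OF matrix_vector_mul_linear_gen matrix_vector_mul_linear_gen])
        (use assms in \<open>auto simp: v_def\<close>)
  qed
  then show ?thesis by (simp add: matrix_eq)
qed

text \<open>Values on the basis vectors are free; the assumption keeps \<open>g\<close> consistent
  with the zero vectors \<open>v j p\<close> past the end of a chain.\<close>

lemma matrix_exists:
  assumes "\<And>j p. S j \<le> p \<Longrightarrow> g j p = 0"
  obtains X :: "'a ^ 'n ^ 'n" where "\<And>j p. X *v v j p = g j p"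
proof -
  let ?I = "{(j, p). p < S j}" and ?v = "\<lambda>(j, p). mat_pow J p *v u j"
  obtain f where f: "Vector_Spaces.linear (*s) (*s) f"
    "\<And>x. x \<in> ?v ` ?I \<Longrightarrow> f x = (\<lambda>(j, p). g j p) (the_inv_into ?I ?v x)"
    using vec.linear_independent_extend
      [OF independent, of "\<lambda>x. (\<lambda>(j, p). g j p) (the_inv_into ?I ?v x)"] by blast
  have "matrix f *v v j p = g j p" for j p
  proof (cases "p < S j")
    case True
    then have "f (?v (j, p)) = g j p"
      by (subst f(2)) (use the_inv_into_f_f[OF inj, of "(j, p)"] in force)+
    then show ?thesis using matrix_works[OF f(1)] by (simp add: v_def)
  next
    case False
    then show ?thesis using assms[of j p] v_eq_0[of j p] by simp
  qed
  then show thesis by (rule that)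
qed

lemma square_root_exists:
  assumes pairs: "\<And>k. S (2 * k) \<le> Suc (S (Suc (2 * k)))"
  shows "\<exists>Q. J = Q ** Q"
proof -
  \<comment> \<open>Interleaves the chains \<open>2k\<close> and \<open>2k + 1\<close> into one chain.\<close>
  define g where "g j p = (if even j then v (Suc j) p else v (j - 1) (Suc p))" for j p
  \<comment> \<open>An even chain maps into one that is no longer; an odd chain maps into one at
    most one longer, which the shift to \<open>Suc p\<close> absorbs.\<close>
  have "g j p = 0" if "S j \<le> p" for j p
  proof (cases "even j")
    case True
    then show ?thesis
      using that antimonoD[OF antimono, of j "Suc j"] by (simp add: g_def v_eq_0)
  next
    case False
    then obtain k where "j = Suc (2 * k)" by (metis oddE Suc_eq_plus1)
    then show ?thesis
      using that pairs[of k] by (simp add: g_def v_eq_0)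
  qed
  then obtain Q where Q: "\<And>j p. Q *v v j p = g j p"
    using matrix_exists by metis
  have "J *v v j p = Q ** Q *v v j p" for j p
    by (auto simp: J_v Q g_def simp flip: matrix_vector_mul_assoc elim!: oddE)
  then show ?thesis using matrix_eqI by blast
qed

text \<open>Here \<open>J\<close> is in the role of the square root, and \<open>J ** J\<close> is
  the matrix to be written as a commutator.\<close>

lemma square_is_commutator:
  "\<exists>M N. J ** J = M ** N - N ** M \<and> M ** M = 0 \<and> N ** N = 0"
proof -
  \<comment> \<open>The signs run +, +, -, -, so \<open>c p * c (Suc p)\<close> alternates. For even
    \<open>p\<close> only \<open>M ** N\<close> acts, with sign +; for odd \<open>p\<close> only
    \<open>N ** M\<close> acts, with sign -, which the commutator reverses.\<close>
  define c :: "nat \<Rightarrow> 'a" where "c p = (- 1) ^ (p div 2)" for p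
  obtain M where M: "\<And>j p. M *v v j p = (if odd p then c p *s v j (Suc p) else 0)"
    by (rule matrix_exists[where g = "\<lambda>j p. if odd p then c p *s v j (Suc p) else 0"])
      (auto simp: v_eq_0)
  obtain N where N: "\<And>j p. N *v v j p = (if even p then c p *s v j (Suc p) else 0)"
    by (rule matrix_exists[where g = "\<lambda>j p. if even p then c p *s v j (Suc p) else 0"])
      (auto simp: v_eq_0)
  have cc: "c (Suc p) * c p = (if even p then 1 else - 1)" for p
    by (auto simp: c_def power_mult_distrib[symmetric] elim!: evenE oddE)
  have cc': "c p * c (Suc p) = (if even p then 1 else - 1)" for p
    using cc[of p] by (simp add: mult.commute)
  have "J ** J = M ** N - N ** M"
  proof (rule matrix_eqI)
    show "J ** J *v v j p = (M ** N - N ** M) *v v j p" for j p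
      by (simp add: J_v M N cc cc' matrix_vector_mult_diff_rdistrib vec.scale
          flip: matrix_vector_mul_assoc)
  qed
  \<comment> \<open>Each factor raises the position by one, landing in the parity that it
    kills.\<close>
  moreover have "M ** M = 0" "N ** N = 0"
    by (rule matrix_eqI; simp add: M N vec.scale flip: matrix_vector_mul_assoc)+
  ultimately show ?thesis by blast
qed

end

section \<open>Existence of a Jordan basis for a nilpotent matrix\<close>

text \<open>A basis of the kernel adapted to the flag provides the last vectors of the chains; each
  is lifted through as many powers of \<open>J\<close> as the flag allows.\<close>

lemma jordan_basis_exists:
  fixes J :: "'a::field ^ 'n ^ 'n"
  assumes "nilpotent_mat J"
  obtains S u where "jordan_basis J S u" "\<And>i. vec.dim (socle_flag J i) = card {j. i < S j}"
proof -
  obtain m where m: "mat_pow J m = 0"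
    using assms by (auto simp: nilpotent_mat_def)
  let ?E = "socle_flag J"
  have "?E m \<subseteq> {0}"
    by (auto simp: socle_flag_def m)
  then obtain B where B: "vec.independent B" "B \<subseteq> ?E 0" "\<And>i. ?E i \<subseteq> vec.span (B \<inter> ?E i)"
    using flag_basis_exists[OF socle_flag_antimono] by metis
  have notin_m: "e \<notin> ?E m" if "e \<in> B" for e
    using that \<open>?E m \<subseteq> {0}\<close> B(1) vec.dependent_zero by blast
  \<comment> \<open>The first level that \<open>e\<close> leaves is the length of its chain:
    \<open>e\<close> is a value of \<open>mat_pow J (s e - 1)\<close>, but not of
    \<open>mat_pow J (s e)\<close>.\<close>
  define s where "s e = (LEAST i. e \<notin> ?E i)" for e
  have s_iff: "i < s e \<longleftrightarrow> e \<in> ?E i" if "e \<in> B" for e i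
  proof
    assume "i < s e"
    then show "e \<in> ?E i" unfolding s_def by (blast dest: not_less_Least)
  next
    assume "e \<in> ?E i"
    moreover have "e \<notin> ?E (s e)"
      unfolding s_def using notin_m[OF that] by (rule LeastI)
    ultimately show "i < s e"
      using antimonoD[OF socle_flag_antimono, of "s e" i J] by (auto simp: not_less[symmetric])
  qed
  have "\<exists>x. e = mat_pow J (s e - 1) *v x" if "e \<in> B" for e
  proof -
    have "s e - 1 < s e" using s_iff[OF that, of 0] that B(2) by auto
    then show ?thesis using s_iff[OF that] by (auto simp: socle_flag_def)
  qed
  then obtain U where U: "\<And>e. e \<in> B \<Longrightarrow> e = mat_pow J (s e - 1) *v U e"
    by metis
  obtain ys where ys: "set ys = B" "distinct ys"
    using finite_distinct_list[OF vec.finiteI_independent[OF B(1)]] by blast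
  \<comment> \<open>Sorting by decreasing chain length makes \<open>S\<close> antitone.\<close>
  define xs where "xs = rev (sort_key s ys)"
  have xs: "set xs = B" "distinct xs" "sorted (rev (map s xs))"
    using ys by (simp_all add: xs_def rev_map)
  define S where "S j = (if j < length xs then s (xs ! j) else 0)" for j
  define u where "u j = (if j < length xs then U (xs ! j) else 0)" for j
  have S_iff: "i < S j \<longleftrightarrow> j < length xs \<and> xs ! j \<in> ?E i" for i j
    using s_iff[of "xs ! j" i] xs(1) nth_mem[of j xs] by (auto simp: S_def)
  have bottom: "mat_pow J (S j - 1) *v u j = xs ! j" "J *v (xs ! j) = 0" "0 < S j" "S j \<le> m"
    if "j < length xs" for j
  proof -
    have e: "xs ! j \<in> B" using xs(1) that nth_mem by blast
    show "mat_pow J (S j - 1) *v u j = xs ! j"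
      using U[OF e] that by (simp add: S_def u_def)
    show "J *v (xs ! j) = 0"
      using e B(2) by (auto simp: socle_flag_def)
    show "0 < S j"
      using S_iff[of 0 j] e B(2) that by auto
    show "S j \<le> m"
      using S_iff[of m j] notin_m[OF e] by (simp add: not_less[symmetric])
  qed
  have card_eq: "vec.dim (?E i) = card {j. i < S j}" for i
  proof -
    have "(!) xs ` {j. i < S j} = B \<inter> ?E i"
      unfolding S_iff using xs(1) by (auto simp: in_set_conv_nth image_iff)
    moreover have "inj_on ((!) xs) {j. i < S j}"
      unfolding S_iff using xs(2) by (auto simp: inj_on_def nth_eq_iff_index_eq)
    moreover have "card (B \<inter> ?E i) = vec.dim (?E i)"
      using B(3)[of i] vec.independent_mono[OF B(1), of "B \<inter> ?E i"]
      by (intro vec.basis_card_eq_dim) auto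
    ultimately show ?thesis by (metis card_image)
  qed
  let ?I = "{(j, p). p < S j}" and ?v = "\<lambda>(j, p). mat_pow J p *v u j"
  \<comment> \<open>The chains span, and there are exactly as many chain vectors as the dimension; so they are
    distinct and independent.\<close>
  have finS: "finite {j. i < S j}" for i
    unfolding S_iff by simp
  \<comment> \<open>Counting the chain vectors by position instead of by chain turns their number
    into the sum of the flag dimensions.\<close>
  have I: "?I = prod.swap ` (SIGMA i:{..<m}. {j. i < S j})"
  proof -
    have "p < m" if "p < S j" for j p
      using that bottom(4)[of j] S_def[of j] by (auto split: if_splits)
    then show ?thesis by (auto simp: image_iff Bex_def)
  qed
  have finI: "finite ?I"
    unfolding I using finS by simp
  have "card ?I = (\<Sum>i<m. card {j. i < S j})"
    unfolding I using finS by (subst card_image) auto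
  then have cardI: "card ?I = vec.dim (UNIV :: ('a ^ 'n) set)"
    using nilpotent_dim_eq_sum_socle_flag[OF m] by (simp add: card_eq card_cart_basis)
  \<comment> \<open>By induction on \<open>k\<close>: \<open>mat_pow J k *v x\<close> lies in
    \<open>?E k\<close>, whose basis vectors are images under \<open>mat_pow J k\<close> of the
    chain vectors \<open>k\<close> places before the ends. Subtracting a suitable \<open>y\<close>
    from the span leaves a vector killed by \<open>mat_pow J k\<close>.\<close>
  have "x \<in> vec.span (?v ` ?I)" if "mat_pow J k *v x = 0" for k x
    using that
  proof (induction k arbitrary: x)
    case 0
    then show ?case by (simp add: vec.span_zero)
  next
    case (Suc k)
    have "mat_pow J k *v x \<in> ?E k"
      using Suc.prems by (auto simp: socle_flag_def matrix_vector_mul_assoc)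
    moreover have "B \<inter> ?E k \<subseteq> (*v) (mat_pow J k) ` ?v ` ?I"
    proof
      fix e assume e: "e \<in> B \<inter> ?E k"
      then obtain j where j: "j < length xs" "e = xs ! j"
        using xs(1) by (auto simp: in_set_conv_nth)
      then have "k < S j" using e S_iff by blast
      then have "mat_pow J (S j - 1) = mat_pow J k ** mat_pow J (S j - 1 - k)"
        by (simp flip: mat_pow_add)
      then have "e = mat_pow J k *v ?v (j, S j - 1 - k)"
        using bottom(1)[OF j(1)] j(2) by (simp add: matrix_vector_mul_assoc)
      moreover have "(j, S j - 1 - k) \<in> ?I" using bottom(3)[OF j(1)] by simp
      ultimately show "e \<in> (*v) (mat_pow J k) ` ?v ` ?I" by blast
    qed
    ultimately have "mat_pow J k *v x \<in> vec.span ((*v) (mat_pow J k) ` ?v ` ?I)"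
      using B(3)[of k] vec.span_mono by blast
    then obtain y where y: "y \<in> vec.span (?v ` ?I)" "mat_pow J k *v x = mat_pow J k *v y"
      by (auto simp: vec.linear_span_image)
    then have "x - y \<in> vec.span (?v ` ?I)"
      by (intro Suc.IH) (simp add: matrix_vector_mult_diff_distrib)
    then show ?case using vec.span_add[OF _ y(1), of "x - y"] by simp
  qed
  then have span: "vec.span (?v ` ?I) = UNIV"
    using m by (metis UNIV_eq_I matrix_vector_mult_0)
  have "vec.dim (UNIV :: ('a ^ 'n) set) \<le> card (?v ` ?I)"
    using span finI by (intro vec.dim_le_card) auto
  then have card: "card (?v ` ?I) = card ?I"
    using cardI card_image_le[OF finI, of ?v] by simp
  have "jordan_basis J S u"
  proof
    show "antimono S"
    proof (rule antimonoI)
      fix i j :: nat assume "i \<le> j"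
      then show "S j \<le> S i"
        using sorted_rev_nth_mono[OF xs(3), of i j] by (simp add: S_def)
    qed
    show "mat_pow J (S j) *v u j = 0" for j
    proof (cases "j < length xs")
      case True
      then obtain t where "S j = Suc t" using bottom(3) gr0_implies_Suc by blast
      then show ?thesis
        using bottom(1,2)[OF True] by (simp flip: matrix_vector_mul_assoc)
    qed (simp add: u_def)
    show "inj_on ?v ?I"
      using finI card by (rule eq_card_imp_inj_on)
    show "vec.independent (?v ` ?I)"
      using span finI card cardI by (intro vec.card_le_dim_spanning[of _ UNIV]) auto
    show "vec.span (?v ` ?I) = UNIV" by (rule span)
  qed
  then show thesis using that card_eq by blast
qed

section \<open>The two implications\<close>

lemma square_root_if_commutator_of_square_zero:
  fixes J :: "'a::field ^ 'n ^ 'n"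
  assumes nil: "nilpotent_mat J" and J: "J = M ** N - N ** M"
    and M: "M ** M = 0" and N: "N ** N = 0"
  shows "\<exists>Q. J = Q ** Q"
proof -
  obtain S u where "jordan_basis J S u" and dim: "\<And>i. vec.dim (socle_flag J i) = card {j. i < S j}"
    using jordan_basis_exists[OF nil] by blast
  then interpret jordan_basis J S u by simp
  have MM: "M *v (M *v x) = 0" and NN: "N *v (N *v x) = 0" for x
    by (simp_all add: matrix_vector_mul_assoc M N)
  have Jx: "J *v x = M *v (N *v x) - N *v (M *v x)" for x
    by (simp add: J matrix_vector_mult_diff_rdistrib matrix_vector_mul_assoc)
  note distribs = matrix_vector_mult_diff_rdistrib matrix_vector_mult_add_rdistrib
    matrix_vector_right_distrib matrix_vector_mult_diff_distrib
  show ?thesis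
  proof (rule square_root_exists, rule ccontr)
    fix k assume "\<not> S (2 * k) \<le> Suc (S (Suc (2 * k)))"
    \<comment> \<open>A gap of at least two leaves levels \<open>i\<close> and \<open>Suc i\<close>,
      with \<open>i\<close> equal to \<open>S (2 * k) - 2\<close>, both reached by exactly the
      chains 0 to \<open>2 * k\<close>. The flag is stable there, with odd dimension
      \<open>2 * k + 1\<close>, contradicting the parity result.\<close>
    then obtain i where i: "S (2 * k) = Suc (Suc i)" "S (Suc (2 * k)) \<le> i"
      by (metis Suc_le_eq less_eq_Suc_le not_less_eq_eq less_imp_Suc_add add_Suc_right le_add1 not_le)
    have *: "{j. l < S j} = {..2 * k}" if "i \<le> l" "l \<le> Suc i" for l
    proof -
      have "l < S j \<longleftrightarrow> j \<le> 2 * k" for j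
        using antimonoD[OF antimono, of j "2 * k"] antimonoD[OF antimono, of "Suc (2 * k)" j] i that
        by (cases "j \<le> 2 * k") auto
      then show ?thesis by auto
    qed
    then have "socle_flag J (Suc i) = socle_flag J i"
      by (intro vec.subspace_dim_equal)
        (simp_all add: subspace_socle_flag dim antimonoD[OF socle_flag_antimono])
    then have "even (vec.dim (socle_flag J i))"
      by (rule even_dim_stable_socle[where A = "M + N" and B = "M - N", rotated 3])
        (simp_all add: distribs MM NN Jx)
    then show False by (simp add: dim *)
  qed
qed

text \<open>Powers of \<open>Q ** Q\<close> are even powers of \<open>Q\<close>, so \<open>Q\<close>
  is itself nilpotent and has a Jordan basis.\<close>

lemma commutator_of_square_zero_if_square:
  fixes Q :: "'a::field ^ 'n ^ 'n"
  assumes "nilpotent_mat (Q ** Q)"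
  shows "\<exists>M N. Q ** Q = M ** N - N ** M \<and> M ** M = 0 \<and> N ** N = 0"
proof -
  have "mat_pow (Q ** Q) k = mat_pow Q (2 * k)" for k
    by (induction k) (simp_all add: matrix_mul_assoc)
  then have "nilpotent_mat Q"
    using assms by (auto simp: nilpotent_mat_def)
  then obtain S u where "jordan_basis Q S u"
    using jordan_basis_exists by blast
  then show ?thesis by (rule jordan_basis.square_is_commutator)
qed

theorem theorem3p15:
  fixes J :: "complex ^ 'n ^ 'n"
  assumes "CARD('n) \<ge> 2"
    and "nilpotent_mat J"
  shows "(\<exists>M N :: complex ^ 'n ^ 'n. J = M ** N - N ** M \<and> M ** M = 0 \<and> N ** N = 0)
     \<longleftrightarrow> (\<exists>Q :: complex ^ 'n ^ 'n. J = Q ** Q)"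
  using assms(2) square_root_if_commutator_of_square_zero[of J]
    commutator_of_square_zero_if_square by blast

end
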